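(* Let $\mathcal{P}=(G,(D,\sqcap),\delta)$ be a pattern structure such that $(D,\sqcap)$ is a complete semilattice. Then: (1) for any projection (kernel operator) $\psi$ of $D$ we have $\mathbb{R}(\psi(\mathcal{P})) \leq_S \mathbb{R}(\mathcal{P})$; (2) for any formal context $\mathbb{K}=(G,M,I)$ such that $\mathbb{K} \leq_S \mathbb{R}(\mathcal{P})$, there is a projection $\psi$ of $D$ such that $\mathbb{K}$ is a representation context of $\psi(\mathcal{P})$.
   Context: A pattern structure $\mathcal{P}=(G,(D,\sqcap),\delta)$ consists of a set of objects $G$, a meet-semilattice $(D,\sqcap)$ of descriptions with natural order $c\sqsubseteq d \Leftrightarrow c\sqcap d=c$, and a map $\delta: G\to D$ such that $\delta(G)$ generates a complete subsemilattice $(D_\delta,\sqcap)$ of $(D,\sqcap)$, where $D_\delta$ is the set of all meets $\mathop{\sqcap}_{g\in X}\delta(g)$ for $X\subseteq G$. Its Galois connection is $A^\diamond=\mathop{\sqcap}_{g\in A}\delta(g)$ for $A\subseteq G$ and $d^\diamond=\{g\in G \mid d\sqsubseteq \delta(g)\}$ for $d\in D$; pattern extents are sets $A$ with $A^{\diamond\diamond}=A$. The join on $D_\delta$ is $\bigsqcup X = \mathop{\sqcap}\{d\in D_\delta \mid (\forall x\in X)\, x\sqsubseteq d\}$. A set $M\subseteq D$ is $\sqcup$-dense for $D_\delta$ if every element of $D_\delta$ is $\bigsqcup X$ for some $X\subseteq M$; for such $M$, the formal context $(G,M,I)$ with $(g,m)\in I \Leftrightarrow m\sqsubseteq\delta(g)$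 is a representation context of $\mathcal{P}$, denoted $\mathbb{R}(\mathcal{P})$. A projection $\psi: D\to D$ is a kernel operator (monotone, contractive $\psi(x)\sqsubseteq x$, idempotent). The o-projected pattern structure is $\psi(\mathcal{P})=(G,(\psi(D),\sqcap_\psi),\psi\circ\delta)$ where $\psi(D)=\{d\in D\mid \psi(d)=d\}$ and $x\sqcap_\psi y := \psi(x\sqcap y)$. For formal contexts $\mathbb{K}_1=(G,M_1,I_1)$ and $\mathbb{K}_2=(G,M_2,I_2)$ on the same object set, $\mathbb{K}_1 \leq_S \mathbb{K}_2$ ("$\mathbb{K}_1$ is simpler than $\mathbb{K}_2$") means that for every $m\in M_1$ there is a set $B\subseteq M_2$ with $\{m\}^{1}=B^{2}$, where $(\cdot)^1,(\cdot)^2$ are the derivation operators of $\mathbb{K}_1,\mathbb{K}_2$. Contexts are considered up to attribute reduction (attribute-reduced contexts). *)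

theory Defs
  imports "HOL-Algebra.Lattice"
begin

section \<open>Meet-semilattices given by an operation on a carrier\<close>

definition meet_semilattice :: "'d set \<Rightarrow> ('d \<Rightarrow> 'd \<Rightarrow> 'd) \<Rightarrow> bool" where
  "meet_semilattice D m \<longleftrightarrow>
     (\<forall>x\<in>D. \<forall>y\<in>D. m x y \<in> D) \<and>
     (\<forall>x\<in>D. \<forall>y\<in>D. \<forall>z\<in>D. m (m x y) z = m x (m y z)) \<and>
     (\<forall>x\<in>D. \<forall>y\<in>D. m x y = m y x) \<and>
     (\<forall>x\<in>D. m x x = x)"

definition natural_order :: "'d set \<Rightarrow> ('d \<Rightarrow> 'd \<Rightarrow> 'd) \<Rightarrow> 'd gorder" where
  "natural_order D m = \<lparr>carrier = D, eq = (=), le = (\<lambda>c d. m c d = c)\<rparr>"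

definition has_inf :: "('d, 'c) gorder_scheme \<Rightarrow> 'd set \<Rightarrow> bool" where
  "has_inf L X \<longleftrightarrow> (\<exists>i. greatest L i (Lower L X))"

text \<open>All subsets are meant, including the empty one, so a complete semilattice has a top.\<close>

definition complete_semilattice :: "'d set \<Rightarrow> ('d \<Rightarrow> 'd \<Rightarrow> 'd) \<Rightarrow> bool" where
  "complete_semilattice D m \<longleftrightarrow>
     meet_semilattice D m \<and> (\<forall>X. X \<subseteq> D \<longrightarrow> has_inf (natural_order D m) X)"


section \<open>Pattern structures\<close>

record ('g, 'd) pattern =
  objs :: "'g set"
  descs :: "'d set"
  pmeet :: "'d \<Rightarrow> 'd \<Rightarrow> 'd"
  descr :: "'g \<Rightarrow> 'd"

abbreviation desc_order :: "('g, 'd) pattern \<Rightarrow> 'd gorder" where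
  "desc_order P \<equiv> natural_order (descs P) (pmeet P)"

definition pattern_structure :: "('g, 'd) pattern \<Rightarrow> bool" where
  "pattern_structure P \<longleftrightarrow>
     meet_semilattice (descs P) (pmeet P) \<and>
     descr P \<in> objs P \<rightarrow> descs P \<and>
     (\<forall>X. X \<subseteq> objs P \<longrightarrow> has_inf (desc_order P) (descr P ` X))"

definition intent :: "('g, 'd) pattern \<Rightarrow> 'g set \<Rightarrow> 'd" where
  "intent P A = \<Sqinter>\<^bsub>desc_order P\<^esub> (descr P ` A)"

definition generated_descs :: "('g, 'd) pattern \<Rightarrow> 'd set" where
  "generated_descs P = {intent P X | X. X \<subseteq> objs P}"

definition generated_join :: "('g, 'd) pattern \<Rightarrow> 'd set \<Rightarrow> 'd" where
  "generated_join P X =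
     \<Sqinter>\<^bsub>desc_order P\<^esub> {d \<in> generated_descs P. \<forall>x\<in>X. x \<sqsubseteq>\<^bsub>desc_order P\<^esub> d}"

definition join_dense :: "('g, 'd) pattern \<Rightarrow> 'd set \<Rightarrow> bool" where
  "join_dense P M \<longleftrightarrow>
     M \<subseteq> descs P \<and> (\<forall>d \<in> generated_descs P. \<exists>X. X \<subseteq> M \<and> d = generated_join P X)"


section \<open>Formal contexts\<close>

record ('g, 'm) fcontext =
  objects :: "'g set"
  attributes :: "'m set"
  incidence :: "('g \<times> 'm) set"

definition formal_context :: "('g, 'm) fcontext \<Rightarrow> bool" where
  "formal_context K \<longleftrightarrow> incidence K \<subseteq> objects K \<times> attributes K"

definition attr_deriv :: "('g, 'm) fcontext \<Rightarrow> 'm set \<Rightarrow> 'g set" where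
  "attr_deriv K B = {g \<in> objects K. \<forall>m\<in>B. (g, m) \<in> incidence K}"

definition simpler :: "('g, 'm) fcontext \<Rightarrow> ('g, 'n) fcontext \<Rightarrow> bool" (infix \<open>\<le>\<^sub>S\<close> 50) where
  "K1 \<le>\<^sub>S K2 \<longleftrightarrow>
     objects K1 = objects K2 \<and>
     (\<forall>m \<in> attributes K1. \<exists>B. B \<subseteq> attributes K2 \<and> attr_deriv K1 {m} = attr_deriv K2 B)"

definition attribute_reduced :: "('g, 'm) fcontext \<Rightarrow> bool" where
  "attribute_reduced K \<longleftrightarrow>
     \<not> (\<exists>m \<in> attributes K. \<exists>B. B \<subseteq> attributes K - {m} \<and> attr_deriv K {m} = attr_deriv K B)"

text \<open>
  Two contexts on the same objects agree up to the names of attributes: the first becomes the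
  second by renaming its attributes. Attributes can be merged only if they have the same
  extent, so on an attribute-reduced context the renaming is a bijection
  (\<open>attribute_renaming_bij\<close> below); for other contexts this identification is finer than
  identification up to attribute reduction.
\<close>

definition attribute_renaming ::
    "('m \<Rightarrow> 'n) \<Rightarrow> ('g, 'm) fcontext \<Rightarrow> ('g, 'n) fcontext \<Rightarrow> bool" where
  "attribute_renaming f K1 K2 \<longleftrightarrow>
     objects K1 = objects K2 \<and> f ` attributes K1 = attributes K2 \<and>
     (\<forall>g \<in> objects K1. \<forall>m \<in> attributes K1. (g, m) \<in> incidence K1 \<longleftrightarrow> (g, f m) \<in> incidence K2)"

definition same_up_to_attribute_names :: "('g, 'm) fcontext \<Rightarrow> ('g, 'n) fcontext \<Rightarrow> bool" where
  "same_up_to_attribute_names K1 K2 \<longleftrightarrow> (\<exists>f. attribute_renaming f K1 K2)"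

lemma attribute_renaming_bij:
  assumes "attribute_reduced K1" and "attribute_renaming f K1 K2"
  shows "bij_betw f (attributes K1) (attributes K2)"
proof -
  have "m = n" if "m \<in> attributes K1" "n \<in> attributes K1" "f m = f n" for m n
  proof (rule ccontr)
    assume "m \<noteq> n"
    then have "{n} \<subseteq> attributes K1 - {m}" using that by auto
    moreover have "attr_deriv K1 {m} = attr_deriv K1 {n}"
      using that assms(2) by (auto simp: attribute_renaming_def attr_deriv_def)
    ultimately show False using assms(1) that(1) unfolding attribute_reduced_def by blast
  qed
  then show ?thesis using assms(2) by (auto simp: bij_betw_def inj_on_def attribute_renaming_def)
qed


section \<open>Representation contexts\<close>

definition context_of :: "('g, 'd) pattern \<Rightarrow> 'd set \<Rightarrow> ('g, 'd) fcontext" where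
  "context_of P M =
     \<lparr>objects = objs P, attributes = M,
      incidence = {(g, m). g \<in> objs P \<and> m \<in> M \<and> m \<sqsubseteq>\<^bsub>desc_order P\<^esub> descr P g}\<rparr>"

definition representation_context :: "('g, 'd) pattern \<Rightarrow> ('g, 'd) fcontext \<Rightarrow> bool" where
  "representation_context P R \<longleftrightarrow> (\<exists>M. join_dense P M \<and> R = context_of P M)"


section \<open>Projections\<close>

definition projection :: "('g, 'd) pattern \<Rightarrow> ('d \<Rightarrow> 'd) \<Rightarrow> bool" where
  "projection P \<psi> \<longleftrightarrow>
     \<psi> \<in> descs P \<rightarrow> descs P \<and>
     (\<forall>x \<in> descs P. \<forall>y \<in> descs P.
        x \<sqsubseteq>\<^bsub>desc_order P\<^esub> y \<longrightarrow> \<psi> x \<sqsubseteq>\<^bsub>desc_order P\<^esub> \<psi> y) \<and>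
     (\<forall>x \<in> descs P. \<psi> x \<sqsubseteq>\<^bsub>desc_order P\<^esub> x) \<and>
     (\<forall>x \<in> descs P. \<psi> (\<psi> x) = \<psi> x)"

definition projected :: "('d \<Rightarrow> 'd) \<Rightarrow> ('g, 'd) pattern \<Rightarrow> ('g, 'd) pattern" where
  "projected \<psi> P =
     \<lparr>objs = objs P, descs = {d \<in> descs P. \<psi> d = d},
      pmeet = (\<lambda>x y. \<psi> (pmeet P x y)), descr = \<psi> \<circ> descr P\<rparr>"

lemma pattern_structure_projected:
  assumes P: "pattern_structure P" and psi: "projection P \<psi>"
  shows "pattern_structure (projected \<psi> P)"
proof -
  define D where "D = descs P"
  define m where "m = pmeet P"
  define E where "E = {d \<in> D. \<psi> d = d}"
  have mD: "m x y \<in> D" if "x \<in> D" "y \<in> D" for x y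
    using P that by (auto simp: pattern_structure_def meet_semilattice_def D_def m_def)
  have assoc: "m (m x y) z = m x (m y z)" if "x \<in> D" "y \<in> D" "z \<in> D" for x y z
    using P that by (auto simp: pattern_structure_def meet_semilattice_def D_def m_def)
  have comm: "m x y = m y x" if "x \<in> D" "y \<in> D" for x y
    using P that by (auto simp: pattern_structure_def meet_semilattice_def D_def m_def)
  have idem: "m x x = x" if "x \<in> D" for x
    using P that by (auto simp: pattern_structure_def meet_semilattice_def D_def m_def)
  have pD: "\<psi> x \<in> D" if "x \<in> D" for x
    using psi that by (auto simp: projection_def D_def)
  have mono: "m (\<psi> x) (\<psi> y) = \<psi> x" if "x \<in> D" "y \<in> D" "m x y = x" for x y
    using psi that by (auto simp: projection_def D_def m_def natural_order_def)
  have contr: "m (\<psi> x) x = \<psi> x" if "x \<in> D" for x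
    using psi that by (auto simp: projection_def D_def m_def natural_order_def)
  have idp: "\<psi> (\<psi> x) = \<psi> x" if "x \<in> D" for x
    using psi that by (auto simp: projection_def D_def)
  have trans: "m x z = x" if "x \<in> D" "y \<in> D" "z \<in> D" "m x y = x" "m y z = y" for x y z
    using assoc[of x y z] that by simp
  have glb: "m c (m x y) = c" if "c \<in> D" "x \<in> D" "y \<in> D" "m c x = c" "m c y = c" for c x y
    using assoc[of c x y] that by simp
  have le1: "m (m x y) x = m x y" if "x \<in> D" "y \<in> D" for x y
    by (metis assoc comm idem mD that)
  have le2: "m (m x y) y = m x y" if "x \<in> D" "y \<in> D" for x y
    by (metis assoc idem that)
  have anti: "x = y" if "x \<in> D" "y \<in> D" "m x y = x" "m y x = y" for x y
    using comm that by metis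
  have below: "\<psi> (m x y) = x \<longleftrightarrow> m x y = x" if "x \<in> E" "y \<in> D" for x y
    by (metis (mono_tags, lifting) E_def mem_Collect_eq contr le2 mD that trans anti comm le1)
  have pmD: "\<psi> (m x y) \<in> E" if "x \<in> D" "y \<in> D" for x y
    using pD mD idp that by (auto simp: E_def)
  have ED: "x \<in> D" if "x \<in> E" for x using that by (simp add: E_def)
  have pabs: "\<psi> (m (\<psi> u) z) = \<psi> (m u z)" if "u \<in> D" "z \<in> E" for u z
  proof (rule anti)
    have zD: "z \<in> D" and uD: "u \<in> D" using that ED by auto
    show "\<psi> (m (\<psi> u) z) \<in> D" "\<psi> (m u z) \<in> D" using pD mD zD uD by auto
    have "m (m (\<psi> u) z) (m u z) = m (\<psi> u) z"
      by (rule glb) (use mD pD zD uD le2 trans[OF _ _ _ le1 contr] in auto)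
    then show "m (\<psi> (m (\<psi> u) z)) (\<psi> (m u z)) = \<psi> (m (\<psi> u) z)"
      using mono mD pD zD uD by auto
    have "m (\<psi> (m u z)) (\<psi> u) = \<psi> (m u z)" using mono mD le1 zD uD by auto
    moreover have "m (\<psi> (m u z)) z = \<psi> (m u z)"
      using trans[OF _ _ _ contr le2] mD pD zD uD by auto
    ultimately have "m (\<psi> (m u z)) (m (\<psi> u) z) = \<psi> (m u z)"
      using glb mD pD zD uD by auto
    then have "m (\<psi> (\<psi> (m u z))) (\<psi> (m (\<psi> u) z)) = \<psi> (\<psi> (m u z))"
      using mono mD pD zD uD by auto
    then show "m (\<psi> (m u z)) (\<psi> (m (\<psi> u) z)) = \<psi> (m u z)"
      using idp mD zD uD by auto
  qed
  have "meet_semilattice E (\<lambda>x y. \<psi> (m x y))"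
    unfolding meet_semilattice_def
  proof (intro conjI ballI)
    fix x y z assume xyz: "x \<in> E" "y \<in> E" "z \<in> E"
    have "\<psi> (m (\<psi> (m x y)) z) = \<psi> (m (m x y) z)" using pabs mD ED xyz by auto
    also have "\<dots> = \<psi> (m (m y z) x)" using assoc comm mD ED xyz by metis
    also have "\<dots> = \<psi> (m (\<psi> (m y z)) x)" using pabs mD ED xyz by auto
    also have "\<dots> = \<psi> (m x (\<psi> (m y z)))" using comm mD pD ED xyz by metis
    finally show "\<psi> (m (\<psi> (m x y)) z) = \<psi> (m x (\<psi> (m y z)))" .
  next
    fix x y assume "x \<in> E" "y \<in> E"
    then show "\<psi> (m x y) \<in> E" "\<psi> (m x y) = \<psi> (m y x)" using pmD ED comm by auto
  next
    fix x assume "x \<in> E"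
    then show "\<psi> (m x x) = x" using idem by (auto simp: E_def)
  qed
  moreover have dl: "descr P g \<in> D" if "g \<in> objs P" for g
    using P that by (auto simp: pattern_structure_def D_def)
  moreover have "has_inf (natural_order E (\<lambda>x y. \<psi> (m x y))) ((\<psi> \<circ> descr P) ` X)"
    if X: "X \<subseteq> objs P" for X
  proof -
    obtain i where "greatest (natural_order D m) i (Lower (natural_order D m) (descr P ` X))"
      using P X by (auto simp: pattern_structure_def has_inf_def D_def m_def)
    then have i: "i \<in> D" "\<And>g. g \<in> X \<Longrightarrow> m i (descr P g) = i"
        "\<And>c. c \<in> D \<Longrightarrow> (\<And>g. g \<in> X \<Longrightarrow> m c (descr P g) = c) \<Longrightarrow> m c i = c"
      using X dl by (auto simp: greatest_def Lower_def natural_order_def)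
    have iE: "\<psi> i \<in> E" using i pD idp by (auto simp: E_def)
    have lb: "\<psi> (m (\<psi> i) (\<psi> (descr P g))) = \<psi> i" if "g \<in> X" for g
    proof -
      have "descr P g \<in> D" using X that dl by auto
      then show ?thesis using i(1) i(2)[OF that] mono idp by simp
    qed
    have gr: "\<psi> (m c (\<psi> i)) = c"
      if c: "c \<in> E" and *: "\<And>g. g \<in> X \<Longrightarrow> \<psi> (m c (\<psi> (descr P g))) = c" for c
    proof -
      have "m c (descr P g) = c" if "g \<in> X" for g
      proof -
        have g: "descr P g \<in> D" using X that dl by auto
        then have "m c (\<psi> (descr P g)) = c" using *[OF that] below[OF c] pD by auto
        then show ?thesis using trans[OF ED[OF c] pD[OF g] g] contr[OF g] by auto
      qed
      then have "m c i = c" using i(3) ED[OF c] by auto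
      then have "m (\<psi> c) (\<psi> i) = \<psi> c" using mono ED[OF c] i(1) by auto
      then show ?thesis using c by (auto simp: E_def)
    qed
    have "\<psi> (descr P g) \<in> E" if "g \<in> X" for g
      using X that dl pD idp by (auto simp: E_def)
    then show ?thesis unfolding has_inf_def
      by (intro exI[of _ "\<psi> i"])
        (use iE lb gr in \<open>auto simp: greatest_def Lower_def natural_order_def\<close>)
  qed
  ultimately show ?thesis
    using pD idp unfolding pattern_structure_def projected_def
    by (auto simp: E_def D_def m_def o_def)
qed

end

theory Submission
  imports Defs "HOL-Algebra.Complete_Lattice"
begin

text \<open>
  By density, an attribute set of a representation context determines the same object sets as
  arbitrary sets of descriptions do. A fixed point of a projection \<open>\<psi>\<close> lies below \<open>\<psi> x\<close> iff it
  lies below \<open>x\<close>, so attribute extents of the projected structure are extents of the original one.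
  Conversely, if all attribute extents of a context are pattern extents, replace each attribute by
  the intent of its extent, and let \<open>\<psi> x\<close> be the join in \<open>D\<close> of those intents that lie below \<open>x\<close>.
\<close>

section \<open>The natural order as a partial order and as a complete lattice\<close>

lemma natural_order_simps [simp]:
  "carrier (natural_order D m) = D"
  "eq (natural_order D m) = (=)"
  by (simp_all add: natural_order_def)

lemma le_natural_order: "x \<sqsubseteq>\<^bsub>natural_order D m\<^esub> y \<longleftrightarrow> m x y = x"
  by (simp add: natural_order_def)

lemma partial_order_natural_order:
  assumes "meet_semilattice D m"
  shows "partial_order (natural_order D m)"
proof -
  have assoc: "m (m x y) z = m x (m y z)" if "x \<in> D" "y \<in> D" "z \<in> D" for x y z
    using assms that by (auto simp: meet_semilattice_def)
  have trans: "m x z = x" if "x \<in> D" "y \<in> D" "z \<in> D" "m x y = x" "m y z = y" for x y z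
    using assoc[of x y z] that by simp
  have antisym: "x = y" if "x \<in> D" "y \<in> D" "m x y = x" "m y x = y" for x y
  proof -
    have "m x y = m y x" using assms that(1,2) by (simp add: meet_semilattice_def)
    with that(3,4) show ?thesis by simp
  qed
  have refl: "m x x = x" if "x \<in> D" for x
    using assms that by (simp add: meet_semilattice_def)
  show ?thesis
    by unfold_locales
      (simp_all only: natural_order_simps le_natural_order refl, (rule antisym trans; assumption)+)
qed

lemma partial_order_desc_order:
  "pattern_structure P \<Longrightarrow> partial_order (desc_order P)"
  by (simp add: pattern_structure_def partial_order_natural_order)

text \<open>A top together with infima yields suprema as well. This makes joins in \<open>D\<close>
  available for \<open>join_projection\<close>.\<close>

lemma complete_lattice_natural_order:
  assumes "complete_semilattice D m"
  shows "complete_lattice (natural_order D m)"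
proof -
  interpret partial_order "natural_order D m"
    using assms by (simp add: complete_semilattice_def partial_order_natural_order)
  have inf: "\<exists>i. greatest (natural_order D m) i (Lower (natural_order D m) A)" if "A \<subseteq> D" for A
    using assms that by (simp add: complete_semilattice_def has_inf_def)
  \<comment> \<open>Every element is a lower bound of the empty set, so the infimum of
    \<open>{}\<close> is the top.\<close>
  have "Lower (natural_order D m) {} = D" by (simp add: Lower_def)
  then have "\<exists>g. greatest (natural_order D m) g (carrier (natural_order D m))"
    using inf[of "{}"] by simp
  then show ?thesis
    by (rule complete_lattice_criterion1) (rule inf, simp only: natural_order_simps)
qed


section \<open>The Galois connection between object sets and descriptions\<close>

text \<open>Within \<open>objs P\<close>, this is the intersection of the sets d^diamond for d in
  \<open>B\<close>. No attribute set is mentioned, so extents in contexts with different attributes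
  become comparable.\<close>

definition common_objs :: "('g, 'd) pattern \<Rightarrow> 'd set \<Rightarrow> 'g set" where
  "common_objs P B = {g \<in> objs P. \<forall>b\<in>B. b \<sqsubseteq>\<^bsub>desc_order P\<^esub> descr P g}"

lemma common_objs_subset: "common_objs P B \<subseteq> objs P"
  by (auto simp: common_objs_def)

lemma attr_deriv_context_of:
  "B \<subseteq> M \<Longrightarrow> attr_deriv (context_of P M) B = common_objs P B"
  by (auto simp: attr_deriv_def context_of_def common_objs_def)

lemma descr_closed:
  "pattern_structure P \<Longrightarrow> g \<in> objs P \<Longrightarrow> descr P g \<in> descs P"
  by (auto simp: pattern_structure_def)

lemma greatest_intent:
  assumes "pattern_structure P" "A \<subseteq> objs P"
  shows "greatest (desc_order P) (intent P A) (Lower (desc_order P) (descr P ` A))"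
proof -
  have "\<exists>i. greatest (desc_order P) i (Lower (desc_order P) (descr P ` A))"
    using assms by (simp add: pattern_structure_def has_inf_def)
  then show ?thesis unfolding intent_def inf_def by (rule someI_ex)
qed

lemma intent_closed:
  assumes "pattern_structure P" "A \<subseteq> objs P"
  shows "intent P A \<in> descs P"
  using greatest_intent[OF assms] by (auto simp: greatest_def Lower_def)

text \<open>The universal property of the infimum as one equivalence. Its right-hand side amounts to
  \<open>A \<subseteq> common_objs P {d}\<close>, so this is the adjunction behind the Galois
  connection.\<close>

lemma le_intent_iff:
  assumes P: "pattern_structure P" and A: "A \<subseteq> objs P" and d: "d \<in> descs P"
  shows "d \<sqsubseteq>\<^bsub>desc_order P\<^esub> intent P A \<longleftrightarrow> (\<forall>g\<in>A. d \<sqsubseteq>\<^bsub>desc_order P\<^esub> descr P g)"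
proof -
  interpret partial_order "desc_order P"
    using P by (rule partial_order_desc_order)
  have descr: "descr P g \<in> descs P" if "g \<in> A" for g
    using descr_closed[OF P, of g] A that by auto
  have lower: "intent P A \<sqsubseteq>\<^bsub>desc_order P\<^esub> descr P g" if "g \<in> A" for g
    using greatest_intent[OF P A] descr[OF that] that by (auto simp: greatest_def Lower_def)
  have greatest: "d \<sqsubseteq>\<^bsub>desc_order P\<^esub> intent P A"
    if "\<forall>g\<in>A. d \<sqsubseteq>\<^bsub>desc_order P\<^esub> descr P g"
    using greatest_intent[OF P A] d that by (auto simp: greatest_def Lower_def)
  have "d \<sqsubseteq>\<^bsub>desc_order P\<^esub> descr P g"
    if "d \<sqsubseteq>\<^bsub>desc_order P\<^esub> intent P A" "g \<in> A" for g
    using le_trans[OF that(1) lower[OF that(2)]] d descr[OF that(2)] intent_closed[OF P A]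
    by simp
  with greatest show ?thesis by blast
qed

text \<open>Each b in \<open>B\<close> bounds the descriptions of the common objects from below,
  hence lies below their intent. The intent itself lies below all these descriptions. Thus a set of
  descriptions can be traded for a single one.\<close>

lemma common_objs_intent:
  assumes P: "pattern_structure P" and B: "B \<subseteq> descs P"
  shows "common_objs P {intent P (common_objs P B)} = common_objs P B"
proof -
  interpret partial_order "desc_order P"
    using P by (rule partial_order_desc_order)
  let ?A = "common_objs P B"
  have i: "intent P ?A \<in> descs P"
    using P common_objs_subset by (rule intent_closed)
  have "g \<in> ?A" if g: "g \<in> objs P" and le: "intent P ?A \<sqsubseteq>\<^bsub>desc_order P\<^esub> descr P g" for g
  proof -
    have "b \<sqsubseteq>\<^bsub>desc_order P\<^esub> descr P g" if b: "b \<in> B" for b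
    proof -
      have "b \<sqsubseteq>\<^bsub>desc_order P\<^esub> intent P ?A"
        using le_intent_iff[OF P common_objs_subset, of b B] b B by (auto simp: common_objs_def)
      from le_trans[OF this le] show ?thesis using b B i descr_closed[OF P g] by auto
    qed
    with g show ?thesis by (simp add: common_objs_def)
  qed
  moreover have "intent P ?A \<sqsubseteq>\<^bsub>desc_order P\<^esub> descr P g" if "g \<in> ?A" for g
    using le_intent_iff[OF P common_objs_subset i] le_refl[of "intent P ?A"] i that by auto
  moreover have "?A \<subseteq> objs P" by (rule common_objs_subset)
  ultimately show ?thesis
    unfolding common_objs_def[of P "{intent P ?A}"] by blast
qed

text \<open>The generated descriptions are closed elements of the Galois connection, so they are
  determined by their extents.\<close>

lemma intent_common_objs:
  assumes P: "pattern_structure P" and d: "d \<in> generated_descs P"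
  shows "intent P (common_objs P {d}) = d"
proof -
  interpret partial_order "desc_order P"
    using P by (rule partial_order_desc_order)
  obtain X where X: "X \<subseteq> objs P" "d = intent P X"
    using d by (auto simp: generated_descs_def)
  have dD: "d \<in> descs P" using X intent_closed[OF P] by simp
  let ?e = "intent P (common_objs P {d})"
  have eD: "?e \<in> descs P" using P common_objs_subset by (rule intent_closed)
  \<comment> \<open>Passing from \<open>X\<close> to this larger set can only lower the
    intent.\<close>
  have "X \<subseteq> common_objs P {d}"
    using le_intent_iff[OF P X(1) dD] le_refl[of d] X dD by (auto simp: common_objs_def)
  moreover have "\<forall>g\<in>common_objs P {d}. ?e \<sqsubseteq>\<^bsub>desc_order P\<^esub> descr P g"
    using le_intent_iff[OF P common_objs_subset eD] le_refl[of ?e] eD by auto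
  ultimately have "?e \<sqsubseteq>\<^bsub>desc_order P\<^esub> d"
    using le_intent_iff[OF P X(1) eD] X(2) by blast
  moreover have "d \<sqsubseteq>\<^bsub>desc_order P\<^esub> ?e"
    using le_intent_iff[OF P common_objs_subset[of P "{d}"] dD] by (simp add: common_objs_def)
  ultimately show ?thesis using le_antisym[of ?e d] dD eD by auto
qed

lemma descr_generated:
  assumes P: "pattern_structure P" and g: "g \<in> objs P"
  shows "descr P g \<in> generated_descs P"
proof -
  interpret partial_order "desc_order P"
    using P by (rule partial_order_desc_order)
  have gs: "{g} \<subseteq> objs P" using g by simp
  have D: "descr P g \<in> descs P" "intent P {g} \<in> descs P"
    using descr_closed[OF P g] intent_closed[OF P gs] by auto
  then have "intent P {g} = descr P g"
    using le_intent_iff[OF P gs D(1)] le_intent_iff[OF P gs D(2)] le_antisym le_refl by auto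
  with gs show ?thesis unfolding generated_descs_def by (metis (mono_tags, lifting) mem_Collect_eq)
qed

section \<open>Joins of generated descriptions and join-density\<close>

text \<open>The descriptions of the common objects of \<open>X\<close> are among the upper bounds of
  \<open>X\<close> in D_\<delta>, and every such upper bound is an infimum of some of them. Hence
  both families have the same infimum.\<close>

lemma generated_join_eq_intent:
  assumes P: "pattern_structure P" and X: "X \<subseteq> descs P"
  shows "generated_join P X = intent P (common_objs P X)"
proof -
  interpret partial_order "desc_order P"
    using P by (rule partial_order_desc_order)
  let ?L = "desc_order P"
  let ?U = "{d \<in> generated_descs P. \<forall>x\<in>X. x \<sqsubseteq>\<^bsub>?L\<^esub> d}"
  \<comment> \<open>Infima are chosen as greatest elements of \<open>Lower\<close> sets, so equal
    \<open>Lower\<close> sets give equal choices.\<close>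
  have "Lower ?L ?U = Lower ?L (descr P ` common_objs P X)"
  proof (rule subset_antisym)
    have "descr P ` common_objs P X \<subseteq> ?U"
      using descr_generated[OF P] by (auto simp: common_objs_def)
    then show "Lower ?L ?U \<subseteq> Lower ?L (descr P ` common_objs P X)"
      by (rule Lower_antimono)
  next
    have "l \<sqsubseteq>\<^bsub>?L\<^esub> d"
      if l: "l \<in> Lower ?L (descr P ` common_objs P X)" and d: "d \<in> ?U" for l d
    proof -
      obtain A where A: "A \<subseteq> objs P" "d = intent P A"
        using d by (auto simp: generated_descs_def)
      have "x \<sqsubseteq>\<^bsub>?L\<^esub> descr P g" if "x \<in> X" "g \<in> A" for x g
        using le_intent_iff[OF P A(1), of x] that d A(2) X by auto
      then have "A \<subseteq> common_objs P X"
        using A(1) by (auto simp: common_objs_def)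
      then have "\<forall>g\<in>A. l \<sqsubseteq>\<^bsub>?L\<^esub> descr P g"
        using l A(1) descr_closed[OF P] unfolding Lower_def by fastforce
      moreover have "l \<in> descs P" using l by (simp add: Lower_def)
      ultimately show ?thesis using le_intent_iff[OF P A(1)] A(2) by simp
    qed
    then show "Lower ?L (descr P ` common_objs P X) \<subseteq> Lower ?L ?U"
      by (auto simp: Lower_def[of ?L ?U]) (auto simp: Lower_def)
  qed
  then show ?thesis
    unfolding generated_join_def intent_def inf_def by simp
qed

text \<open>Density expresses the intent of the common objects of \<open>C\<close> as a join over
  some \<open>B \<subseteq> M\<close>. Since this join is the intent of the common objects of
  \<open>B\<close>, both extents can be recovered from the same description.\<close>

lemma join_dense_common_objs:
  assumes P: "pattern_structure P" and M: "join_dense P M" and C: "C \<subseteq> descs P"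
  obtains B where "B \<subseteq> M" "common_objs P B = common_objs P C"
proof -
  have "intent P (common_objs P C) \<in> generated_descs P"
    using common_objs_subset by (force simp: generated_descs_def)
  then obtain B where B: "B \<subseteq> M" "intent P (common_objs P C) = generated_join P B"
    using M by (auto simp: join_dense_def)
  then have BD: "B \<subseteq> descs P" using M by (auto simp: join_dense_def)
  have "common_objs P C = common_objs P {intent P (common_objs P C)}"
    using common_objs_intent[OF P C] by simp
  also have "\<dots> = common_objs P {intent P (common_objs P B)}"
    using B(2) generated_join_eq_intent[OF P BD] by simp
  also have "\<dots> = common_objs P B"
    by (rule common_objs_intent[OF P BD])
  finally show ?thesis using that B(1) by simp
qed

text \<open>If the members of \<open>N\<close> below a description detect the order on
  \<open>descs P\<close>, then a generated \<open>d\<close> has the same common objects as the set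
  of all members of \<open>N\<close> below it. Closedness of \<open>d\<close> turns this into a join
  representation.\<close>

lemma join_denseI:
  assumes P: "pattern_structure P" and N: "N \<subseteq> descs P"
    and dense: "\<And>d e. \<lbrakk>d \<in> descs P; e \<in> descs P;
      \<forall>n\<in>N. n \<sqsubseteq>\<^bsub>desc_order P\<^esub> d \<longrightarrow> n \<sqsubseteq>\<^bsub>desc_order P\<^esub> e\<rbrakk> \<Longrightarrow> d \<sqsubseteq>\<^bsub>desc_order P\<^esub> e"
  shows "join_dense P N"
  unfolding join_dense_def
proof (intro conjI ballI)
  interpret partial_order "desc_order P"
    using P by (rule partial_order_desc_order)
  fix d assume d: "d \<in> generated_descs P"
  then have dD: "d \<in> descs P" by (auto simp: generated_descs_def intent_closed[OF P])
  let ?Y = "{n \<in> N. n \<sqsubseteq>\<^bsub>desc_order P\<^esub> d}"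
  have "(\<forall>n\<in>?Y. n \<sqsubseteq>\<^bsub>desc_order P\<^esub> descr P g) \<longleftrightarrow> d \<sqsubseteq>\<^bsub>desc_order P\<^esub> descr P g"
    if "g \<in> objs P" for g
  proof
    have gD: "descr P g \<in> descs P" using P that by (rule descr_closed)
    show "d \<sqsubseteq>\<^bsub>desc_order P\<^esub> descr P g" if "\<forall>n\<in>?Y. n \<sqsubseteq>\<^bsub>desc_order P\<^esub> descr P g"
      using that by (intro dense dD gD) simp
    show "\<forall>n\<in>?Y. n \<sqsubseteq>\<^bsub>desc_order P\<^esub> descr P g" if "d \<sqsubseteq>\<^bsub>desc_order P\<^esub> descr P g"
    proof
      fix n assume n: "n \<in> ?Y"
      then have "n \<sqsubseteq>\<^bsub>desc_order P\<^esub> d" by simp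
      from le_trans[OF this that] show "n \<sqsubseteq>\<^bsub>desc_order P\<^esub> descr P g"
        using n N dD gD by auto
    qed
  qed
  then have "common_objs P ?Y = common_objs P {d}"
    by (auto simp: common_objs_def)
  moreover have "?Y \<subseteq> descs P" using N by auto
  ultimately have "d = generated_join P ?Y"
    using generated_join_eq_intent[OF P, of ?Y] intent_common_objs[OF P d] by simp
  moreover have "?Y \<subseteq> N" by (rule Collect_subset)
  ultimately show "\<exists>X\<subseteq>N. d = generated_join P X" by (intro exI[of _ ?Y] conjI)
qed (rule N)


section \<open>Order and extents in a projected structure\<close>

lemma projected_simps [simp]:
  "objs (projected \<psi> P) = objs P"
  "descs (projected \<psi> P) = {d \<in> descs P. \<psi> d = d}"
  "descr (projected \<psi> P) g = \<psi> (descr P g)"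
  by (simp_all add: projected_def)

text \<open>If \<psi> sends the meet of \<open>x\<close> and \<open>y\<close> to \<open>x\<close>,
  contraction puts \<open>x\<close> below that meet and so below \<open>y\<close>. Conversely, if
  the meet is \<open>x\<close> already, \<psi> leaves it fixed.\<close>

lemma le_projected_iff:
  assumes P: "meet_semilattice (descs P) (pmeet P)" and psi: "projection P \<psi>"
    and x: "x \<in> descs P" "\<psi> x = x" and y: "y \<in> descs P"
  shows "x \<sqsubseteq>\<^bsub>desc_order (projected \<psi> P)\<^esub> y \<longleftrightarrow> x \<sqsubseteq>\<^bsub>desc_order P\<^esub> y"
proof
  interpret partial_order "desc_order P"
    using P by (rule partial_order_natural_order)
  let ?m = "pmeet P x y"
  have m: "?m \<in> descs P" using P x y by (simp add: meet_semilattice_def)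
  assume "x \<sqsubseteq>\<^bsub>desc_order (projected \<psi> P)\<^esub> y"
  then have "\<psi> ?m = x" by (simp add: le_natural_order projected_def)
  then have "x \<sqsubseteq>\<^bsub>desc_order P\<^esub> ?m" using psi m by (auto simp: projection_def)
  moreover have "?m \<sqsubseteq>\<^bsub>desc_order P\<^esub> y"
    using P x(1) y unfolding le_natural_order meet_semilattice_def by metis
  ultimately show "x \<sqsubseteq>\<^bsub>desc_order P\<^esub> y" using le_trans[of x ?m y] x y m by simp
next
  assume "x \<sqsubseteq>\<^bsub>desc_order P\<^esub> y"
  then show "x \<sqsubseteq>\<^bsub>desc_order (projected \<psi> P)\<^esub> y"
    using x by (simp add: le_natural_order projected_def)
qed

text \<open>Contraction gives one direction; monotonicity together with \<open>\<psi> x = x\<close>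
  gives the other.\<close>

lemma fixed_le_projection_iff:
  assumes P: "meet_semilattice (descs P) (pmeet P)" and psi: "projection P \<psi>"
    and x: "x \<in> descs P" "\<psi> x = x" and y: "y \<in> descs P"
  shows "x \<sqsubseteq>\<^bsub>desc_order P\<^esub> \<psi> y \<longleftrightarrow> x \<sqsubseteq>\<^bsub>desc_order P\<^esub> y"
proof -
  interpret partial_order "desc_order P"
    using P by (rule partial_order_natural_order)
  have "\<psi> y \<in> descs P" "\<psi> y \<sqsubseteq>\<^bsub>desc_order P\<^esub> y"
    using psi y by (auto simp: projection_def)
  then have "x \<sqsubseteq>\<^bsub>desc_order P\<^esub> \<psi> y \<Longrightarrow> x \<sqsubseteq>\<^bsub>desc_order P\<^esub> y"
    using le_trans[of x "\<psi> y" y] x y by simp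
  moreover have "x \<sqsubseteq>\<^bsub>desc_order P\<^esub> y \<Longrightarrow> x \<sqsubseteq>\<^bsub>desc_order P\<^esub> \<psi> y"
    using psi x y by (metis projection_def)
  ultimately show ?thesis by blast
qed

text \<open>Projecting changes both the order and the object descriptions, but on fixed points
  neither change is visible.\<close>

lemma common_objs_projected:
  assumes P: "pattern_structure P" and psi: "projection P \<psi>"
    and B: "B \<subseteq> descs (projected \<psi> P)"
  shows "common_objs (projected \<psi> P) B = common_objs P B"
proof -
  have S: "meet_semilattice (descs P) (pmeet P)"
    using P by (simp add: pattern_structure_def)
  have "b \<sqsubseteq>\<^bsub>desc_order (projected \<psi> P)\<^esub> \<psi> (descr P g) \<longleftrightarrow> b \<sqsubseteq>\<^bsub>desc_order P\<^esub> descr P g"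
    if "b \<in> B" "g \<in> objs P" for b g
  proof -
    have b: "b \<in> descs P" "\<psi> b = b" using that B by auto
    have g: "descr P g \<in> descs P" "\<psi> (descr P g) \<in> descs P"
      using descr_closed[OF P that(2)] psi by (auto simp: projection_def)
    show ?thesis
      using le_projected_iff[OF S psi b g(2)] fixed_le_projection_iff[OF S psi b g(1)] by simp
  qed
  then show ?thesis by (auto simp: common_objs_def)
qed

section \<open>Representation contexts of a projection compared with those of the original
  structure\<close>

text \<open>The extent of an attribute \<open>m\<close> of \<open>R'\<close> is
  \<open>common_objs P {m}\<close>. Density of \<open>M\<close> replaces \<open>{m}\<close> by a
  subset of \<open>M\<close> with the same common objects.\<close>

lemma simpler_projected:
  assumes P: "pattern_structure P" and psi: "projection P \<psi>"
    and R: "representation_context P R"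
    and R': "representation_context (projected \<psi> P) R'"
  shows "R' \<le>\<^sub>S R"
proof -
  obtain M where M: "join_dense P M" "R = context_of P M"
    using R by (auto simp: representation_context_def)
  obtain M' where M': "join_dense (projected \<psi> P) M'" "R' = context_of (projected \<psi> P) M'"
    using R' by (auto simp: representation_context_def)
  have "\<exists>B\<subseteq>M. attr_deriv R' {m} = attr_deriv R B" if m: "m \<in> M'" for m
  proof -
    have fixed: "{m} \<subseteq> descs (projected \<psi> P)" using M'(1) m by (auto simp: join_dense_def)
    then have "{m} \<subseteq> descs P" by simp
    then obtain B where B: "B \<subseteq> M" "common_objs P B = common_objs P {m}"
      by (rule join_dense_common_objs[OF P M(1)])
    have "attr_deriv R' {m} = common_objs (projected \<psi> P) {m}"
      unfolding M'(2) by (rule attr_deriv_context_of) (use m in simp)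
    also have "\<dots> = attr_deriv R B"
      using common_objs_projected[OF P psi fixed] B attr_deriv_context_of[OF B(1), of P] M(2)
      by simp
    finally show ?thesis using B(1) by blast
  qed
  moreover have "attributes R = M" "attributes R' = M'" "objects R' = objects R"
    using M M' by (simp_all add: context_of_def)
  ultimately show ?thesis by (simp add: simpler_def)
qed


section \<open>The projection onto joins of a set of descriptions\<close>

text \<open>The join is taken in \<open>D\<close>, unlike \<open>generated_join\<close>. For
  \<open>N\<close> inside a complete \<open>D\<close>, the fixed points are the joins of subsets of
  \<open>N\<close>.\<close>

definition join_projection :: "('g, 'd) pattern \<Rightarrow> 'd set \<Rightarrow> 'd \<Rightarrow> 'd" where
  "join_projection P N x = \<Squnion>\<^bsub>desc_order P\<^esub> {n \<in> N. n \<sqsubseteq>\<^bsub>desc_order P\<^esub> x}"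

context
  fixes P :: "('g, 'd) pattern" and N :: "'d set"
  assumes complete: "complete_semilattice (descs P) (pmeet P)"
    and N: "N \<subseteq> descs P"
begin

interpretation partial_order "desc_order P"
  using complete by (simp add: complete_semilattice_def partial_order_natural_order)

text \<open>The universal property of the join, on which the facts about
  \<open>join_projection\<close> below rest.\<close>

lemma join_projection_closed: "join_projection P N x \<in> descs P"
  and le_join_projection:
    "n \<in> N \<Longrightarrow> n \<sqsubseteq>\<^bsub>desc_order P\<^esub> x \<Longrightarrow> n \<sqsubseteq>\<^bsub>desc_order P\<^esub> join_projection P N x"
  and join_projection_le:
    "\<lbrakk>y \<in> descs P; \<And>n. n \<in> N \<Longrightarrow> n \<sqsubseteq>\<^bsub>desc_order P\<^esub> x \<Longrightarrow> n \<sqsubseteq>\<^bsub>desc_order P\<^esub> y\<rbrakk>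
      \<Longrightarrow> join_projection P N x \<sqsubseteq>\<^bsub>desc_order P\<^esub> y"
proof -
  let ?Y = "{n \<in> N. n \<sqsubseteq>\<^bsub>desc_order P\<^esub> x}"
  have Y: "?Y \<subseteq> carrier (desc_order P)" using N by auto
  interpret complete_lattice "desc_order P"
    using complete by (rule complete_lattice_natural_order)
  show "join_projection P N x \<in> descs P"
    using sup_closed[OF Y] unfolding join_projection_def natural_order_simps .
  show "n \<sqsubseteq>\<^bsub>desc_order P\<^esub> join_projection P N x" if "n \<in> N" "n \<sqsubseteq>\<^bsub>desc_order P\<^esub> x"
    unfolding join_projection_def by (rule sup_upper[OF Y]) (use that in blast)
  show "join_projection P N x \<sqsubseteq>\<^bsub>desc_order P\<^esub> y"
    if "y \<in> descs P" "\<And>n. n \<in> N \<Longrightarrow> n \<sqsubseteq>\<^bsub>desc_order P\<^esub> x \<Longrightarrow> n \<sqsubseteq>\<^bsub>desc_order P\<^esub> y"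
    unfolding join_projection_def
    by (rule sup_least[OF Y]) (use that in \<open>auto simp only: natural_order_simps mem_Collect_eq\<close>)
qed

lemma join_projection_fixed:
  assumes "n \<in> N"
  shows "join_projection P N n = n"
  using le_antisym[of n "join_projection P N n"] join_projection_le[of n n]
    le_join_projection[of n n] join_projection_closed assms N by auto

text \<open>A larger \<open>x\<close> admits more members of \<open>N\<close>, and \<open>x\<close>
  bounds those below it, so the map is monotone and contractive.\<close>

lemma projection_join_projection: "projection P (join_projection P N)"
  unfolding projection_def
proof (intro conjI ballI impI funcsetI)
  fix x y assume xy: "x \<in> descs P" "y \<in> descs P" "x \<sqsubseteq>\<^bsub>desc_order P\<^esub> y"
  show "join_projection P N x \<sqsubseteq>\<^bsub>desc_order P\<^esub> join_projection P N y"
  proof (rule join_projection_le[OF join_projection_closed])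
    fix n assume n: "n \<in> N" "n \<sqsubseteq>\<^bsub>desc_order P\<^esub> x"
    have "n \<sqsubseteq>\<^bsub>desc_order P\<^esub> y" using le_trans[OF n(2) xy(3)] n(1) xy N by auto
    with n(1) show "n \<sqsubseteq>\<^bsub>desc_order P\<^esub> join_projection P N y" by (rule le_join_projection)
  qed
next
  fix x assume x: "x \<in> descs P"
  let ?p = "join_projection P N"
  show le: "?p x \<sqsubseteq>\<^bsub>desc_order P\<^esub> x"
    using join_projection_le x by simp
  have "?p (?p x) \<sqsubseteq>\<^bsub>desc_order P\<^esub> ?p x"
    using join_projection_le join_projection_closed by simp
  \<comment> \<open>A member of \<open>N\<close> below \<open>x\<close> is below
    \<open>?p x\<close>, and by the same argument below \<open>?p (?p x)\<close>.\<close>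
  moreover have "?p x \<sqsubseteq>\<^bsub>desc_order P\<^esub> ?p (?p x)"
    using join_projection_le join_projection_closed le_join_projection by simp
  ultimately show "?p (?p x) = ?p x"
    using le_antisym join_projection_closed by simp
qed (rule join_projection_closed)

lemma join_dense_join_projection:
  assumes P: "pattern_structure P"
  shows "join_dense (projected (join_projection P N) P) N"
proof (rule join_denseI)
  let ?p = "join_projection P N"
  let ?Q = "projected ?p P"
  show "pattern_structure ?Q"
    using P projection_join_projection by (rule pattern_structure_projected)
  show N_fixed: "N \<subseteq> descs ?Q" using N join_projection_fixed by auto
  have S: "meet_semilattice (descs P) (pmeet P)"
    using P by (simp add: pattern_structure_def)
  have le_iff: "x \<sqsubseteq>\<^bsub>desc_order ?Q\<^esub> y \<longleftrightarrow> x \<sqsubseteq>\<^bsub>desc_order P\<^esub> y"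
    if "x \<in> descs ?Q" "y \<in> descs ?Q" for x y
    using le_projected_iff[OF S projection_join_projection] that by simp
  fix d e assume d: "d \<in> descs ?Q" and e: "e \<in> descs ?Q"
    and below: "\<forall>n\<in>N. n \<sqsubseteq>\<^bsub>desc_order ?Q\<^esub> d \<longrightarrow> n \<sqsubseteq>\<^bsub>desc_order ?Q\<^esub> e"
  \<comment> \<open>A fixed point \<open>d\<close> equals \<open>?p d\<close>, the join of the
    members of \<open>N\<close> below it, so comparing those members with \<open>e\<close>
    suffices.\<close>
  have "?p d \<sqsubseteq>\<^bsub>desc_order P\<^esub> e"
  proof (rule join_projection_le)
    show "e \<in> descs P" using e by simp
    fix n assume n: "n \<in> N" "n \<sqsubseteq>\<^bsub>desc_order P\<^esub> d"
    then have "n \<in> descs ?Q" using N_fixed by blast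
    with n below show "n \<sqsubseteq>\<^bsub>desc_order P\<^esub> e" using le_iff[OF _ d] le_iff[OF _ e] by blast
  qed
  then show "d \<sqsubseteq>\<^bsub>desc_order ?Q\<^esub> e" using le_iff[OF d e] d by simp
qed

end

section \<open>Realising simpler contexts by projections\<close>

text \<open>Attributes of \<open>K\<close> may have any type, so they are renamed to descriptions.
  The renaming merges exactly the attributes with equal extents.\<close>

lemma simpler_imp_projected:
  assumes P: "pattern_structure P"
    and complete: "complete_semilattice (descs P) (pmeet P)"
    and R: "representation_context P R" and K: "objects K = objs P" "K \<le>\<^sub>S R"
  obtains \<psi> R' where "projection P \<psi>" "representation_context (projected \<psi> P) R'"
    "same_up_to_attribute_names K R'"
proof -
  obtain M where M: "join_dense P M" "R = context_of P M"
    using R by (auto simp: representation_context_def)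
  define f where "f m = intent P (attr_deriv K {m})" for m
  define N where "N = f ` attributes K"
  \<comment> \<open>By \<open>K \<le>\<^sub>S R\<close> the extent of \<open>m\<close> is the set of
    common objects of some descriptions, hence it is recovered from its intent
    \<open>f m\<close>.\<close>
  have extent: "f m \<in> descs P" "common_objs P {f m} = attr_deriv K {m}"
    if m: "m \<in> attributes K" for m
  proof -
    have "attributes R = M" using M(2) by (simp add: context_of_def)
    then obtain B where "B \<subseteq> M" "attr_deriv K {m} = attr_deriv R B"
      using K(2) m by (auto simp: simpler_def)
    then have B: "B \<subseteq> M" "attr_deriv K {m} = common_objs P B"
      using attr_deriv_context_of M(2) by simp_all
    then have "B \<subseteq> descs P" using M(1) by (auto simp: join_dense_def)
    then show "f m \<in> descs P" "common_objs P {f m} = attr_deriv K {m}"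
      using intent_closed[OF P common_objs_subset] common_objs_intent[OF P] B(2)
      by (simp_all add: f_def)
  qed
  then have N: "N \<subseteq> descs P" by (auto simp: N_def)
  define \<psi> where "\<psi> = join_projection P N"
  have psi: "projection P \<psi>"
    using projection_join_projection[OF complete N] by (simp add: \<psi>_def)
  have dense: "join_dense (projected \<psi> P) N"
    using join_dense_join_projection[OF complete N P] by (simp add: \<psi>_def)
  let ?R = "context_of (projected \<psi> P) N"
  have "(g, m) \<in> incidence K \<longleftrightarrow> (g, f m) \<in> incidence ?R"
    if g: "g \<in> objs P" and m: "m \<in> attributes K" for g m
  proof -
    have fm: "{f m} \<subseteq> N" using m by (simp add: N_def)
    \<comment> \<open>Incidence with one attribute is membership in the extent of its singleton, so
      it suffices to compare extents.\<close>
    then have "attr_deriv ?R {f m} = common_objs (projected \<psi> P) {f m}"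
      by (rule attr_deriv_context_of)
    \<comment> \<open>Here \<open>join_dense\<close> supplies that the members of \<open>N\<close>
      are fixed by \<psi>.\<close>
    also have "\<dots> = common_objs P {f m}"
      by (rule common_objs_projected[OF P psi]) (use fm dense in \<open>auto simp: join_dense_def\<close>)
    also have "\<dots> = attr_deriv K {m}" by (rule extent(2)[OF m])
    finally have "g \<in> attr_deriv ?R {f m} \<longleftrightarrow> g \<in> attr_deriv K {m}" by simp
    moreover have "objects ?R = objs P" by (simp add: context_of_def)
    ultimately show ?thesis using g K(1) by (simp add: attr_deriv_def)
  qed
  then have "attribute_renaming f K ?R"
    using K(1) by (simp add: attribute_renaming_def) (simp add: context_of_def N_def)
  with psi dense show ?thesis
    using that by (auto simp: representation_context_def same_up_to_attribute_names_def)
qed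

theorem theorem5:
  fixes P :: "('g, 'd) pattern"
  assumes "pattern_structure P"
    and "complete_semilattice (descs P) (pmeet P)"
  shows "(\<forall>\<psi> R R'. projection P \<psi> \<and> representation_context P R \<and>
            representation_context (projected \<psi> P) R' \<longrightarrow> R' \<le>\<^sub>S R) \<and>
         (\<forall>R (K :: ('g, 'm) fcontext). representation_context P R \<and>
            formal_context K \<and> objects K = objs P \<and> K \<le>\<^sub>S R \<longrightarrow>
            (\<exists>\<psi> R'. projection P \<psi> \<and> representation_context (projected \<psi> P) R' \<and>
               same_up_to_attribute_names K R'))"
  using simpler_projected[OF assms(1)] simpler_imp_projected[OF assms] by metis

end
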